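(* Consider an instance of the five-ball input for some radius $0\le r\le3\times10^{-3}$. Then the optimal value of the linear program (LP2) for this instance is strictly smaller than the optimal value of the K-means clustering problem with $K=2$, written as $$\min\Big\{\sum_{i,j\in[n]}d_{ij}X_{ij}\ :\ X=\frac{1}{|\Gamma_1|}\mathbf{1}_{\Gamma_1}\mathbf{1}_{\Gamma_1}^T+\frac{1}{|\Gamma_2|}\mathbf{1}_{\Gamma_2}\mathbf{1}_{\Gamma_2}^T,\ \{\Gamma_1,\Gamma_2\}\text{ a partition of }[n]\Big\}.$$
   Context: Five-ball input: let $$x^1=\Big(0,\tfrac{\sqrt3}{3},0\Big),\ x^2=\Big(\tfrac12,-\tfrac{\sqrt3}{6},0\Big),\ x^3=\Big(-\tfrac12,-\tfrac{\sqrt3}{6},0\Big),\ x^4=\Big(0,0,\tfrac12\Big),\ x^5=\Big(0,0,-\tfrac12\Big)$$ in $\mathbb{R}^3$. An instance of the five-ball input with radius $r\ge0$ consists of $n=5n'$ points $y^1,\dots,y^n\in\mathbb{R}^3$, for some integer $n'\ge1$, such that for each $p\in\{1,\dots,5\}$ exactly $n'$ of the points (indexed by a block $\{(p-1)n'+1,\dots,pn'\}$) lie in the closed ball of radius $r$ centered at $x^p$. Set $d_{ij}=\|y^i-y^j\|_2^2$. $[n]:=\{1,\dots,n\}$; a partition of $[n]$ into two parts consists of two non-empty disjoint subsets with union $[n]$; $\mathbf{1}_\Gamma\in\mathbb{R}^n$ is the indicator vector of $\Gamma$. (LP2) is the linear program in the entries of a symmetric matrix $X\in\mathbb{R}^{n\times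 n}$ ($X_{ij}=X_{ji}$): minimize $\sum_{i,j\in[n]}d_{ij}X_{ij}$ subject to $\mathrm{Tr}(X)=2$; $\sum_{j=1}^nX_{ij}=1$ for all $i\in[n]$; $X_{ij}+X_{ik}\le X_{ii}+X_{jk}$ for all pairwise distinct $i,j,k\in[n]$ with $j<k$; $X_{ij}\ge0$ for all $1\le i<j\le n$. *)

theory Defs
  imports "HOL-Analysis.Analysis"
begin

text \<open>
  The number of points varies, so points are families indexed by \<open>{1..n}\<close>
  and \<open>n \<times> n\<close> matrices are functions \<open>nat \<Rightarrow> nat \<Rightarrow> real\<close> of which only the entries with
  both indices in \<open>{1..n}\<close> matter.
\<close>

definition center :: "nat \<Rightarrow> real ^ 3" where
  "center p =
    [vector [0, sqrt 3 / 3, 0],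
     vector [1/2, - sqrt 3 / 6, 0],
     vector [- 1/2, - sqrt 3 / 6, 0],
     vector [0, 0, 1/2],
     vector [0, 0, - 1/2]] ! (p - 1)"

text \<open>
  Exactly the points of the \<open>p\<close>-th block lie in the ball around the \<open>p\<close>-th center. Once the
  five balls are disjoint, this just says that each block lies in its ball.
\<close>

definition five_ball_instance :: "real \<Rightarrow> nat \<Rightarrow> (nat \<Rightarrow> real ^ 3) \<Rightarrow> bool" where
  "five_ball_instance r n y \<longleftrightarrow>
    (\<exists>n'\<ge>1. n = 5 * n' \<and>
      (\<forall>p\<in>{1..5}. {i \<in> {1..n}. y i \<in> cball (center p) r} = {(p - 1) * n' + 1..p * n'}))"

definition sqdist :: "(nat \<Rightarrow> real ^ 3) \<Rightarrow> nat \<Rightarrow> nat \<Rightarrow> real" where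
  "sqdist y i j = (norm (y i - y j))\<^sup>2"

definition objective :: "nat \<Rightarrow> (nat \<Rightarrow> nat \<Rightarrow> real) \<Rightarrow> (nat \<Rightarrow> nat \<Rightarrow> real) \<Rightarrow> real" where
  "objective n d X = (\<Sum>i\<in>{1..n}. \<Sum>j\<in>{1..n}. d i j * X i j)"

definition LP2_feasible :: "nat \<Rightarrow> (nat \<Rightarrow> nat \<Rightarrow> real) set" where
  "LP2_feasible n = {X.
     (\<forall>i\<in>{1..n}. \<forall>j\<in>{1..n}. X i j = X j i) \<and>
     (\<Sum>i\<in>{1..n}. X i i) = 2 \<and>
     (\<forall>i\<in>{1..n}. (\<Sum>j\<in>{1..n}. X i j) = 1) \<and>
     (\<forall>i\<in>{1..n}. \<forall>j\<in>{1..n}. \<forall>k\<in>{1..n}.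
        i \<noteq> j \<and> i \<noteq> k \<and> j < k \<longrightarrow> X i j + X i k \<le> X i i + X j k) \<and>
     (\<forall>i\<in>{1..n}. \<forall>j\<in>{1..n}. i < j \<longrightarrow> 0 \<le> X i j)}"

text \<open>
  The optimal value is taken in the extended reals, so that it is meaningful without first
  establishing feasibility and boundedness.
\<close>

definition LP2_value :: "nat \<Rightarrow> (nat \<Rightarrow> nat \<Rightarrow> real) \<Rightarrow> ereal" where
  "LP2_value n d = (INF X\<in>LP2_feasible n. ereal (objective n d X))"

definition partition2 :: "nat \<Rightarrow> nat set \<Rightarrow> nat set \<Rightarrow> bool" where
  "partition2 n \<Gamma>1 \<Gamma>2 \<longleftrightarrow> \<Gamma>1 \<noteq> {} \<and> \<Gamma>2 \<noteq> {} \<and> \<Gamma>1 \<inter> \<Gamma>2 = {} \<and> \<Gamma>1 \<union> \<Gamma>2 = {1..n}"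

definition cluster_matrix :: "nat set \<Rightarrow> nat set \<Rightarrow> nat \<Rightarrow> nat \<Rightarrow> real" where
  "cluster_matrix \<Gamma>1 \<Gamma>2 i j =
     1 / real (card \<Gamma>1) * (indicator \<Gamma>1 i * indicator \<Gamma>1 j) +
     1 / real (card \<Gamma>2) * (indicator \<Gamma>2 i * indicator \<Gamma>2 j)"

text \<open>The minimum is over a finite set, which is nonempty as soon as \<open>n \<ge> 2\<close>.\<close>

definition kmeans2_value :: "nat \<Rightarrow> (nat \<Rightarrow> nat \<Rightarrow> real) \<Rightarrow> real" where
  "kmeans2_value n d =
     Min {objective n d X | X. \<exists>\<Gamma>1 \<Gamma>2. partition2 n \<Gamma>1 \<Gamma>2 \<and> X = cluster_matrix \<Gamma>1 \<Gamma>2}"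

end

theory Submission
  imports Defs
begin

text \<open>
  Up to a perturbation caused by the radius, the points are the five centers, each repeated
  \<open>m\<close> times (\<open>n = 5 m\<close>). The centers form a triangle with side 1 and a pair of apices at
  distance 1 from each other, and every triangle vertex has squared distance \<open>7/12\<close> from
  every apex. For the centers themselves both optimal values can be separated:

  \<^item> A matrix that is constant on blocks and respects the symmetry triangle/apices is feasible
    for the linear program and has value \<open>27/14 m < 1.929 m\<close> (\<open>lp_weight_feasible\<close>).

  \<^item> The barycenter of the centers is \<open>0\<close>. Hence the value of a clustering \<open>(A, B)\<close> is a constant
    minus \<open>2 n |s|\<^sup>2 / (|A| |B|)\<close>, where \<open>s\<close> is the sum of the points in \<open>A\<close>
    (\<open>objective_cluster_centered\<close>). In terms of the fraction of each block that lies in \<open>A\<close>, the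
    upper bound needed on \<open>|s|\<^sup>2\<close> says that a function is nonpositive on the cube
    \<open>[0,1]\<^sup>5\<close>; it is convex in each coordinate, so only the 32 vertices matter, that is,
    the clusterings that do not split a block (\<open>norm_weighted_center_sum_le\<close>). The resulting
    bound is \<open>73/36 m > 2.027 m\<close>.

  The gap is almost \<open>0.1 m\<close>. Moving the points by at most \<open>r \<le> 3/1000\<close> changes each squared
  distance, which is at most 1 for the centers, by little more than \<open>4 r \<le> 12/1000\<close>. Every
  clustering matrix has nonnegative entries with sum \<open>n = 5 m\<close>, so the clustering value drops by
  at most \<open>0.06 m\<close>. For the linear program only the mass \<open>3 m\<close> outside the diagonal blocks
  feels the first-order change, since distances within a block are of second order in \<open>r\<close>; the
  value rises by less than \<open>0.037 m\<close>. This leaves \<open>1.965 m < 1.967 m\<close>.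
\<close>

section \<open>The five centers\<close>

definition center_sqdist :: "nat \<Rightarrow> nat \<Rightarrow> real" where
  "center_sqdist p q =
    (if p = q then 0 else if (p \<le> 3) = (q \<le> 3) then 1 else 7/12)"

lemma atLeastAtMost_1_5: "{1..5::nat} = {1, 2, 3, 4, 5}"
  by auto

lemma norm_sq_vec3: "(norm (x :: real ^ 3))\<^sup>2 = x $ 1 * x $ 1 + x $ 2 * x $ 2 + x $ 3 * x $ 3"
  by (simp add: power2_norm_eq_inner inner_vec_def sum_3)

lemma center_simps:
  "center (Suc 0) = vector [0, sqrt 3 / 3, 0]"
  "center 1 = vector [0, sqrt 3 / 3, 0]"
  "center 2 = vector [1/2, - sqrt 3 / 6, 0]"
  "center 3 = vector [- 1/2, - sqrt 3 / 6, 0]"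
  "center 4 = vector [0, 0, 1/2]"
  "center 5 = vector [0, 0, - 1/2]"
  by (simp_all add: center_def)

lemma norm_center_diff:
  assumes "p \<in> {1..5}" "q \<in> {1..5}"
  shows "(norm (center p - center q))\<^sup>2 = center_sqdist p q"
  using assms unfolding atLeastAtMost_1_5
  by (auto simp: center_simps center_sqdist_def norm_sq_vec3 algebra_simps vector_3)

lemma sum_center: "(\<Sum>p\<in>{1..5}. center p) = 0"
  unfolding atLeastAtMost_1_5
  by (simp add: center_simps vec_eq_iff forall_3 vector_3)

lemma sum_norm_center_sq: "(\<Sum>p\<in>{1..5}. (norm (center p))\<^sup>2) = 3/2"
  unfolding atLeastAtMost_1_5
  by (simp add: center_simps norm_sq_vec3 vector_3)

text \<open>
  The bound \<open>s\<close> on the unperturbed distance appears in the first-order term, so that for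
  coinciding centers (\<open>s = 0\<close>) the perturbation is purely quadratic in \<open>r\<close>.
\<close>

lemma sqdist_perturbed_upper:
  fixes u v a b :: "'a :: real_normed_vector"
  assumes "dist a u \<le> r" "dist b v \<le> r" "norm (a - b) \<le> s"
  shows "(norm (u - v))\<^sup>2 \<le> (norm (a - b))\<^sup>2 + 4 * r * s + 4 * r\<^sup>2"
proof -
  have r: "0 \<le> r"
    using assms(1) zero_le_dist order_trans by blast
  have "norm (u - v) \<le> norm (a - b) + 2 * r"
    using assms(1,2) dist_triangle[of u v a] dist_triangle[of a v b]
    by (simp add: dist_norm norm_minus_commute)
  then have "(norm (u - v))\<^sup>2 \<le> (norm (a - b) + 2 * r)\<^sup>2"
    by (intro power_mono) auto
  also have "\<dots> = (norm (a - b))\<^sup>2 + 4 * r * norm (a - b) + 4 * r\<^sup>2"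
    by (simp add: power2_eq_square algebra_simps)
  also have "\<dots> \<le> (norm (a - b))\<^sup>2 + 4 * r * s + 4 * r\<^sup>2"
    using r assms(3) by (simp add: mult_left_mono)
  finally show ?thesis .
qed

text \<open>
  Dropping a square suffices: \<open>(t - 2 r)\<^sup>2 \<ge> t\<^sup>2 - 4 r t\<close> where \<open>t = |a - b|\<close>.
  If \<open>t < 2 r\<close>, the triangle inequality gives nothing, but then \<open>t\<^sup>2 - 4 r t \<le> 0\<close>.
\<close>

lemma sqdist_perturbed_lower:
  fixes u v a b :: "'a :: real_normed_vector"
  assumes "dist a u \<le> r" "dist b v \<le> r" "norm (a - b) \<le> s"
  shows "(norm (a - b))\<^sup>2 - 4 * r * s \<le> (norm (u - v))\<^sup>2"
proof -
  let ?t = "norm (a - b)"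
  have r: "0 \<le> r"
    using assms(1) zero_le_dist order_trans by blast
  have *: "?t - 2 * r \<le> norm (u - v)"
    using assms(1,2) dist_triangle[of a b u] dist_triangle[of u b v]
    by (simp add: dist_norm norm_minus_commute)
  have "?t\<^sup>2 - 4 * r * s \<le> ?t\<^sup>2 - 4 * r * ?t"
    using r assms(3) by (simp add: mult_left_mono)
  also have "\<dots> \<le> (norm (u - v))\<^sup>2"
  proof (cases "2 * r \<le> ?t")
    case True
    have "?t\<^sup>2 - 4 * r * ?t \<le> (?t - 2 * r)\<^sup>2"
      by (simp add: power2_eq_square algebra_simps)
    also have "\<dots> \<le> (norm (u - v))\<^sup>2"
      using True * by (intro power_mono) auto
    finally show ?thesis .
  next
    case False
    then have "?t * (?t - 4 * r) \<le> 0"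
      using r by (intro mult_nonneg_nonpos) auto
    then have "?t\<^sup>2 - 4 * r * ?t \<le> 0"
      by (simp add: power2_eq_square algebra_simps)
    then show ?thesis
      using zero_le_power2 order_trans by blast
  qed
  finally show ?thesis .
qed

section \<open>Blocks of indices\<close>

definition block :: "nat \<Rightarrow> nat \<Rightarrow> nat" where
  "block m i = (i - 1) div m + 1"

lemma block_eq_iff:
  assumes "m \<ge> 1" "i \<ge> 1" "p \<ge> 1"
  shows "block m i = p \<longleftrightarrow> i \<in> {(p - 1) * m + 1..p * m}"
proof -
  obtain q where q: "p = Suc q" using assms(3) by (cases p) auto
  obtain j where j: "i = Suc j" using assms(2) by (cases i) auto
  have "j div m = q \<longleftrightarrow> q * m \<le> j \<and> j < Suc q * m"
    using assms(1) by (metis div_nat_eqI dividend_less_times_div div_times_less_eq_dividend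
        less_eq_Suc_le mult.commute mult_Suc_right One_nat_def)
  then show ?thesis by (auto simp: block_def q j)
qed

lemma block_range:
  assumes "m \<ge> 1" "i \<in> {1..5 * m}"
  shows "block m i \<in> {1..5}"
proof -
  have "(i - 1) div m < 5"
    using assms by (intro less_mult_imp_div_less) auto
  then show ?thesis by (simp add: block_def)
qed

lemma sum_block:
  fixes f :: "nat \<Rightarrow> 'a :: real_vector"
  assumes "m \<ge> 1" "S \<subseteq> {1..5 * m}"
  shows "(\<Sum>i\<in>S. f (block m i)) = (\<Sum>p\<in>{1..5}. real (card {i\<in>S. block m i = p}) *\<^sub>R f p)"
proof -
  have fin: "finite S"
    using assms(2) finite_subset by blast
  have "(\<Sum>i\<in>S. f (block m i)) = (\<Sum>p\<in>{1..5}. \<Sum>i\<in>{i\<in>S. block m i = p}. f (block m i))"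
    using fin block_range[OF assms(1)] assms(2) by (subst sum.group) auto
  also have "\<dots> = (\<Sum>p\<in>{1..5}. real (card {i\<in>S. block m i = p}) *\<^sub>R f p)"
    by (intro sum.cong refl) (simp add: sum_constant_scaleR)
  finally show ?thesis .
qed

lemma card_block:
  assumes "m \<ge> 1" "p \<in> {1..5}"
  shows "card {i \<in> {1..5 * m}. block m i = p} = m"
proof -
  have le: "p * m \<le> 5 * m" using assms by simp
  have "i \<in> {1..5 * m} \<and> block m i = p \<longleftrightarrow> i \<in> {(p - 1) * m + 1..p * m}" for i
    using order_trans[OF _ le, of i] assms block_eq_iff[OF assms(1), of i p] by (cases "i \<ge> 1") auto
  then have "{i \<in> {1..5 * m}. block m i = p} = {(p - 1) * m + 1..p * m}"
    by blast
  moreover have "p * m = (p - 1) * m + m"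
    using assms(2) by (cases p) auto
  ultimately show ?thesis by simp
qed

lemma sum_all_blocks:
  fixes f :: "nat \<Rightarrow> 'a :: real_vector"
  assumes "m \<ge> 1"
  shows "(\<Sum>i\<in>{1..5 * m}. f (block m i)) = real m *\<^sub>R (\<Sum>p\<in>{1..5}. f p)"
  unfolding sum_block[OF assms order_refl] scaleR_sum_right
  by (intro sum.cong refl) (simp only: card_block[OF assms])

lemma instance_in_balls:
  assumes "\<forall>p\<in>{1..5}. {i \<in> {1..5 * m}. y i \<in> cball (center p) r} = {(p - 1) * m + 1..p * m}"
    and "m \<ge> 1" "i \<in> {1..5 * m}"
  shows "dist (center (block m i)) (y i) \<le> r"
proof -
  have "block m i \<in> {1..5}" using block_range assms by blast
  moreover from this have "i \<in> {(block m i - 1) * m + 1..block m i * m}"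
    using block_eq_iff[of m i "block m i"] assms by auto
  ultimately show ?thesis using assms(1) by force
qed

section \<open>A cheap feasible point of the linear program\<close>

text \<open>
  A symmetric matrix invariant under permuting the triangle vertices and swapping the apices has
  five parameters: diagonal entries \<open>a\<close> (vertices) and \<open>e\<close> (apices), and off-diagonal entries
  \<open>b\<close> (two vertices), \<open>f\<close> (two apices) and \<open>c\<close> (a vertex and an apex). The trace and row sum
  constraints turn the objective \<open>6 b + 2 f + 7 c\<close> into \<open>3 - 5 c\<close>, and the constraints
  \<open>2 c \<le> a + f\<close> and \<open>2 c \<le> e + b\<close> into \<open>2 c \<le> a\<close> and \<open>3 c \<le> 3/2 - 2 a\<close>. The
  largest possible \<open>c\<close> makes both of them equalities, which determines the values below.
\<close>

definition lp_weight :: "nat \<Rightarrow> nat \<Rightarrow> real" where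
  "lp_weight p q =
    (if p = q then (if p \<le> 3 then 3/7 else 5/14)
     else if (p \<le> 3) \<noteq> (q \<le> 3) then 3/14
     else if p \<le> 3 then 1/14 else 0)"

text \<open>
  Distinct points may lie in the same block, so spreading the weights over blocks calls for the
  triangle constraint at coinciding indices too.
\<close>

lemma lp_weight_triangle: "lp_weight p q + lp_weight p s \<le> lp_weight p p + lp_weight q s"
  by (auto simp: lp_weight_def)

lemma lp_weight_feasible:
  assumes "m \<ge> 1"
  shows "(\<lambda>i j. lp_weight (block m i) (block m j) / m) \<in> LP2_feasible (5 * m)"
proof -
  have row: "(\<Sum>q\<in>{1..5}. lp_weight p q) = 1" if "p \<in> {1..5}" for p
    using that unfolding atLeastAtMost_1_5 by (auto simp: lp_weight_def)
  have trace: "(\<Sum>p\<in>{1..5}. lp_weight p p) = 2"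
    unfolding atLeastAtMost_1_5 by (auto simp: lp_weight_def)
  have "(\<Sum>i\<in>{1..5 * m}. lp_weight (block m i) (block m i) / m) = 2"
    using sum_all_blocks[OF assms, of "\<lambda>p. lp_weight p p / m"] assms trace
    by (simp add: sum_divide_distrib[symmetric])
  moreover have "(\<Sum>j\<in>{1..5 * m}. lp_weight (block m i) (block m j) / m) = 1"
    if "i \<in> {1..5 * m}" for i
    using sum_all_blocks[OF assms, of "\<lambda>q. lp_weight (block m i) q / m"] assms
      row[OF block_range[OF assms that]]
    by (simp add: sum_divide_distrib[symmetric])
  moreover have "lp_weight p q / m = lp_weight q p / m" for p q
    by (simp add: lp_weight_def)
  moreover have "lp_weight p q / m + lp_weight p s / m \<le> lp_weight p p / m + lp_weight q s / m"
    for p q s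
    using lp_weight_triangle[of p q s] unfolding add_divide_distrib[symmetric]
    by (intro divide_right_mono) auto
  moreover have "0 \<le> lp_weight p q / m" for p q
    by (simp add: lp_weight_def)
  ultimately show ?thesis
    unfolding LP2_feasible_def by blast
qed

lemma LP2_value_upper:
  assumes m: "m \<ge> 1" and r: "r \<le> 3/1000"
    and ball: "\<And>i. i \<in> {1..5 * m} \<Longrightarrow> dist (center (block m i)) (y i) \<le> r"
  shows "LP2_value (5 * m) (sqdist y) \<le> ereal (m * 1.965)"
proof -
  define e :: "nat \<Rightarrow> nat \<Rightarrow> real" where
    "e p q = center_sqdist p q + (if p = q then 0 else 12/1000) + 36/1000000" for p q
  \<comment> \<open>\<open>12/1000\<close> bounds \<open>4 r\<close> and \<open>36/1000000\<close> bounds \<open>4 r\<^sup>2\<close>.\<close>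
  let ?X = "\<lambda>i j. lp_weight (block m i) (block m j) / m"
  have "0 \<le> r"
    using m by (intro order_trans[OF zero_le_dist ball[of 1]]) simp
  then have r2: "r\<^sup>2 \<le> (3/1000)\<^sup>2"
    using r by (intro power_mono)
  have d: "sqdist y i j \<le> e (block m i) (block m j)"
    if "i \<in> {1..5 * m}" "j \<in> {1..5 * m}" for i j
  proof -
    let ?p = "block m i" and ?q = "block m j"
    have D: "(norm (center ?p - center ?q))\<^sup>2 = center_sqdist ?p ?q"
      using norm_center_diff block_range that m by blast
    define s :: real where "s = (if ?p = ?q then 0 else 1)"
    have "(norm (center ?p - center ?q))\<^sup>2 \<le> s\<^sup>2"
      unfolding D by (simp add: center_sqdist_def s_def)
    then have "norm (center ?p - center ?q) \<le> s"
      by (rule power2_le_imp_le) (simp add: s_def)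
    from sqdist_perturbed_upper[OF ball[OF that(1)] ball[OF that(2)] this]
    have "sqdist y i j \<le> center_sqdist ?p ?q + 4 * r * s + 4 * r\<^sup>2"
      unfolding D sqdist_def .
    then show ?thesis using r r2 by (auto simp: e_def s_def power2_eq_square)
  qed
  have "objective (5 * m) (sqdist y) ?X
      \<le> (\<Sum>i\<in>{1..5 * m}. \<Sum>j\<in>{1..5 * m}. e (block m i) (block m j) * ?X i j)"
    unfolding objective_def
    by (intro sum_mono mult_right_mono d) (auto simp: lp_weight_def)
  also have "\<dots> = (\<Sum>i\<in>{1..5 * m}. \<Sum>q\<in>{1..5}. e (block m i) q * lp_weight (block m i) q)"
  proof (rule sum.cong[OF refl])
    fix i
    show "(\<Sum>j\<in>{1..5 * m}. e (block m i) (block m j) * ?X i j)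
        = (\<Sum>q\<in>{1..5}. e (block m i) q * lp_weight (block m i) q)"
      using sum_all_blocks[OF m, of "\<lambda>q. e (block m i) q * lp_weight (block m i) q / m"] m
      by (simp add: sum_divide_distrib[symmetric])
  qed
  also have "\<dots> = m * (\<Sum>p\<in>{1..5}. \<Sum>q\<in>{1..5}. e p q * lp_weight p q)"
    using sum_all_blocks[OF m, of "\<lambda>p. \<Sum>q\<in>{1..5}. e p q * lp_weight p q"] by simp
  also have "(\<Sum>p\<in>{1..5}. \<Sum>q\<in>{1..5}. e p q * lp_weight p q) \<le> 1.965"
    unfolding atLeastAtMost_1_5 by (simp add: e_def center_sqdist_def lp_weight_def)
  finally have "objective (5 * m) (sqdist y) ?X \<le> m * 1.965"
    using m by (simp add: mult_left_mono)
  moreover have "LP2_value (5 * m) (sqdist y) \<le> ereal (objective (5 * m) (sqdist y) ?X)"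
    unfolding LP2_value_def by (intro INF_lower lp_weight_feasible m)
  ultimately show ?thesis
    using order_trans ereal_less_eq(3) by blast
qed

section \<open>The objective of a clustering\<close>

lemma objective_cluster_matrix:
  assumes "partition2 n A B"
  shows "objective n d (cluster_matrix A B)
    = (\<Sum>i\<in>A. \<Sum>j\<in>A. d i j) / card A + (\<Sum>i\<in>B. \<Sum>j\<in>B. d i j) / card B"
proof -
  have restrict: "(\<Sum>i\<in>{1..n}. \<Sum>j\<in>{1..n}. d i j * (indicator S i * indicator S j))
      = (\<Sum>i\<in>S. \<Sum>j\<in>S. d i j)" if "S \<subseteq> {1..n}" for S
  proof -
    have "(\<Sum>j\<in>{1..n}. d i j * (indicator S i * indicator S j))
        = (if i \<in> S then \<Sum>j\<in>S. d i j else 0)" for i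
      using that by (auto intro!: sum.mono_neutral_cong_right simp: indicator_def)
    then show ?thesis
      using that by (auto intro!: sum.mono_neutral_cong_right)
  qed
  have AB: "A \<subseteq> {1..n}" "B \<subseteq> {1..n}"
    using assms by (auto simp: partition2_def)
  have "objective n d (cluster_matrix A B)
      = (\<Sum>i\<in>{1..n}. \<Sum>j\<in>{1..n}. d i j * (indicator A i * indicator A j)) / card A
      + (\<Sum>i\<in>{1..n}. \<Sum>j\<in>{1..n}. d i j * (indicator B i * indicator B j)) / card B"
    unfolding objective_def cluster_matrix_def sum_divide_distrib sum.distrib[symmetric]
    by (intro sum.cong refl) (simp add: algebra_simps add_divide_distrib)
  then show ?thesis
    using restrict AB by simp
qed

text \<open>
  After expanding the norms, the cross terms add up to the squared norm of the sum. This turns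
  the quadratic number of distances in a cluster into its second moment and its sum.
\<close>

lemma sum_pairwise_sqdist:
  fixes z :: "'i \<Rightarrow> 'a :: real_inner"
  shows "(\<Sum>i\<in>S. \<Sum>j\<in>S. (norm (z i - z j))\<^sup>2)
    = 2 * card S * (\<Sum>i\<in>S. (norm (z i))\<^sup>2) - 2 * (norm (\<Sum>i\<in>S. z i))\<^sup>2"
proof -
  have "(\<Sum>i\<in>S. \<Sum>j\<in>S. (norm (z i - z j))\<^sup>2)
      = (\<Sum>i\<in>S. \<Sum>j\<in>S. (norm (z i))\<^sup>2 + (norm (z j))\<^sup>2 - 2 * (z i \<bullet> z j))"
    by (simp add: power2_norm_eq_inner inner_diff inner_commute algebra_simps)
  also have "\<dots> = 2 * card S * (\<Sum>i\<in>S. (norm (z i))\<^sup>2) - 2 * (\<Sum>i\<in>S. \<Sum>j\<in>S. z i \<bullet> z j)"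
    by (simp add: sum.distrib sum_subtractf sum_distrib_left[symmetric])
  also have "(\<Sum>i\<in>S. \<Sum>j\<in>S. z i \<bullet> z j) = (norm (\<Sum>i\<in>S. z i))\<^sup>2"
    unfolding power2_norm_eq_inner inner_sum_left inner_sum_right by (rule sum.swap)
  finally show ?thesis .
qed

text \<open>
  When the points have barycenter \<open>0\<close>, the sums over the two clusters are opposite, and
  \<open>1/|A| + 1/|B| = n / (|A| |B|)\<close>.
\<close>

lemma objective_cluster_centered:
  fixes z :: "nat \<Rightarrow> 'a :: real_inner"
  assumes part: "partition2 n A B" and centered: "(\<Sum>i\<in>{1..n}. z i) = 0"
  shows "objective n (\<lambda>i j. (norm (z i - z j))\<^sup>2) (cluster_matrix A B)
    = 2 * (\<Sum>i\<in>{1..n}. (norm (z i))\<^sup>2)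
      - 2 * n * (norm (\<Sum>i\<in>A. z i))\<^sup>2 / (card A * card B)"
proof -
  have un: "A \<union> B = {1..n}" and disj: "A \<inter> B = {}"
    and ne: "A \<noteq> {}" "B \<noteq> {}"
    using part by (auto simp: partition2_def)
  then have fin: "finite A" "finite B"
    by (metis finite_Un finite_atLeastAtMost)+
  have n: "n = card A + card B"
    using card_Un_disjoint[OF fin disj] un by simp
  have pos: "card A > 0" "card B > 0"
    using ne fin by (auto simp: card_gt_0_iff)
  have split: "(\<Sum>i\<in>{1..n}. f i) = (\<Sum>i\<in>A. f i) + (\<Sum>i\<in>B. f i)"
    for f :: "nat \<Rightarrow> 'b :: comm_monoid_add"
    unfolding un[symmetric] by (rule sum.union_disjoint[OF fin disj])
  have "(\<Sum>i\<in>B. z i) = - (\<Sum>i\<in>A. z i)"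
    using centered split[of z] by (simp add: eq_neg_iff_add_eq_0 add.commute)
  then have opposite: "norm (\<Sum>i\<in>B. z i) = norm (\<Sum>i\<in>A. z i)"
    by simp
  show ?thesis
    unfolding objective_cluster_matrix[OF part] sum_pairwise_sqdist opposite split
    using pos by (simp add: n field_simps)
qed

section \<open>How far apart two clusters of the centers can be\<close>

text \<open>
  Moving one coordinate at a time to an endpoint of \<open>[0,1]\<close> reaches a vertex, and by convexity
  along the coordinate line one of the two endpoints does not decrease the function.
\<close>

lemma coordinatewise_convex_le_at_vertices:
  fixes f :: "('i \<Rightarrow> real) \<Rightarrow> real"
  assumes "finite I"
    and "\<And>i w. i \<in> I \<Longrightarrow> convex_on {0..1} (\<lambda>t. f (w(i := t)))"
    and "\<And>v. (\<And>i. i \<in> I \<Longrightarrow> v i \<in> {0, 1}) \<Longrightarrow> (\<And>i. i \<notin> I \<Longrightarrow> v i = w i) \<Longrightarrow> f v \<le> c"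
    and "\<And>i. i \<in> I \<Longrightarrow> w i \<in> {0..1}"
  shows "f w \<le> c"
  using assms
proof (induction I arbitrary: w rule: finite_induct)
  case empty
  then show ?case by blast
next
  case (insert k I)
  have vertex: "f (w(k := t)) \<le> c" if t: "t \<in> {0, 1}" for t
  proof (rule insert.IH)
    show "f v \<le> c"
      if "\<And>i. i \<in> I \<Longrightarrow> v i \<in> {0, 1}" "\<And>i. i \<notin> I \<Longrightarrow> v i = (w(k := t)) i" for v
    proof (rule insert.prems(2))
      show "v i \<in> {0, 1}" if "i \<in> insert k I" for i
        using that t insert.hyps(2) \<open>\<And>i. i \<in> I \<Longrightarrow> v i \<in> {0, 1}\<close>
          \<open>\<And>i. i \<notin> I \<Longrightarrow> v i = (w(k := t)) i\<close>[of k] by auto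
      show "v i = w i" if "i \<notin> insert k I" for i
        using that \<open>\<And>i. i \<notin> I \<Longrightarrow> v i = (w(k := t)) i\<close>[of i] by auto
    qed
  next
    show "(w(k := t)) i \<in> {0..1}" if "i \<in> I" for i
      using insert.prems(3)[of i] insert.hyps(2) that by auto
  qed (use insert.prems(1) in auto)
  have "f (w(k := (1 - w k) *\<^sub>R 0 + w k *\<^sub>R 1))
      \<le> (1 - w k) * f (w(k := 0)) + w k * f (w(k := 1))"
    using insert.prems(3)[of k] by (intro convex_onD[OF insert.prems(1)]) auto
  also have "\<dots> \<le> (1 - w k) * c + w k * c"
    using insert.prems(3)[of k] vertex by (intro add_mono mult_left_mono) auto
  also have "\<dots> = c"
    by (simp add: algebra_simps)
  finally show ?case
    by simp
qed

lemma convex_on_quadratic: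
  fixes a b c :: real
  assumes "0 \<le> a" "convex S"
  shows "convex_on S (\<lambda>t. a * t\<^sup>2 + b * t + c)"
proof (rule convex_onI)
  fix t x y :: real
  assume t: "0 < t" "t < 1"
  have "(1 - t) * (a * x\<^sup>2 + b * x + c) + t * (a * y\<^sup>2 + b * y + c)
      - (a * ((1 - t) *\<^sub>R x + t *\<^sub>R y)\<^sup>2 + b * ((1 - t) *\<^sub>R x + t *\<^sub>R y) + c)
      = a * (t * (1 - t)) * (x - y)\<^sup>2"
    by (simp add: power2_eq_square algebra_simps)
  moreover have "0 \<le> a * (t * (1 - t)) * (x - y)\<^sup>2"
    using assms t by simp
  ultimately show "a * ((1 - t) *\<^sub>R x + t *\<^sub>R y)\<^sup>2 + b * ((1 - t) *\<^sub>R x + t *\<^sub>R y) + c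
      \<le> (1 - t) * (a * x\<^sup>2 + b * x + c) + t * (a * y\<^sup>2 + b * y + c)"
    by linarith
qed (use assms in auto)

text \<open>
  The difference of the two sides is quadratic in each \<open>w p\<close>, with leading coefficient
  \<open>|center p|\<^sup>2 + 7/72\<close>. Equality holds at the vertices that separate one triangle vertex
  and one apex from the other three centers: these are the optimal clusterings of the centers, and they fix the
  constant \<open>7/72\<close>.
\<close>

lemma norm_weighted_center_sum_le:
  assumes "\<And>p. p \<in> {1..5} \<Longrightarrow> w p \<in> {0..1}"
  shows "(norm (\<Sum>p\<in>{1..5}. w p *\<^sub>R center p))\<^sup>2
    \<le> 7/72 * ((\<Sum>p\<in>{1..5}. w p) * (5 - (\<Sum>p\<in>{1..5}. w p)))"
proof -
  define f where "f w = (norm (\<Sum>p\<in>{1..5}. w p *\<^sub>R center p))\<^sup>2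
    - 7/72 * ((\<Sum>p\<in>{1..5}. w p) * (5 - (\<Sum>p\<in>{1..5}. w p)))" for w :: "nat \<Rightarrow> real"
  have "f w \<le> 0"
  proof (rule coordinatewise_convex_le_at_vertices[where f = f and I = "{1..5}"])
    fix k :: nat and w :: "nat \<Rightarrow> real"
    assume k: "k \<in> {1..5}"
    let ?J = "{1..5} - {k}"
    define b where "b = (\<Sum>p\<in>?J. w p *\<^sub>R center p)"
    define e where "e = (\<Sum>p\<in>?J. w p)"
    have sums: "(\<Sum>p\<in>{1..5}. (w(k := t)) p *\<^sub>R center p) = t *\<^sub>R center k + b"
      "(\<Sum>p\<in>{1..5}. (w(k := t)) p) = t + e" for t
      unfolding b_def e_def using k by (auto simp: sum.remove intro!: sum.cong)
    have "(norm (t *\<^sub>R center k + b))\<^sup>2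
        = (norm (center k))\<^sup>2 * t\<^sup>2 + 2 * (center k \<bullet> b) * t + (norm b)\<^sup>2" for t
      unfolding power2_norm_eq_inner
      by (simp add: inner_add inner_commute power2_eq_square algebra_simps)
    then have "f (w(k := t)) = ((norm (center k))\<^sup>2 + 7/72) * t\<^sup>2
        + (2 * (center k \<bullet> b) - 7/72 * (5 - 2 * e)) * t + ((norm b)\<^sup>2 - 7/72 * (e * (5 - e)))" for t
      unfolding f_def sums
      by (simp add: field_simps power2_eq_square[of t] power2_eq_square[of e])
    then show "convex_on {0..1} (\<lambda>t. f (w(k := t)))"
      using convex_on_quadratic[of "(norm (center k))\<^sup>2 + 7/72" "{0..1}"] by simp
  next
    fix v :: "nat \<Rightarrow> real"
    assume v: "\<And>p. p \<in> {1..5} \<Longrightarrow> v p \<in> {0, 1}"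
    have "v 1 \<in> {0, 1}" "v 2 \<in> {0, 1}" "v 3 \<in> {0, 1}" "v 4 \<in> {0, 1}" "v 5 \<in> {0, 1}"
      by (rule v, simp)+
    then show "f v \<le> 0"
      unfolding f_def atLeastAtMost_1_5
      by (auto simp: center_simps norm_sq_vec3 vector_3 field_simps)
  qed (use assms in auto)
  then show ?thesis by (simp add: f_def)
qed

text \<open>
  Per copy of the centers, the bound is \<open>2 (3/2) - 10 (7/72) = 73/36\<close>: the first term is twice the second moment of the
  five centers, the second comes from the bound on the weighted sum of centers.
\<close>

lemma objective_centers_lower:
  assumes m: "m \<ge> 1" and part: "partition2 (5 * m) A B"
  shows "73/36 * m \<le> objective (5 * m)
    (\<lambda>i j. (norm (center (block m i) - center (block m j)))\<^sup>2) (cluster_matrix A B)"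
proof -
  \<comment> \<open>The fraction of the \<open>p\<close>-th block that belongs to \<open>A\<close>.\<close>
  define w where "w p = card {i\<in>A. block m i = p} / m" for p
  have un: "A \<union> B = {1..5 * m}" and disj: "A \<inter> B = {}" and ne: "A \<noteq> {}" "B \<noteq> {}"
    using part by (auto simp: partition2_def)
  then have fin: "finite A" "finite B"
    by (metis finite_Un finite_atLeastAtMost)+
  have A: "A \<subseteq> {1..5 * m}" using un by auto
  have pos: "card A > 0" "card B > 0"
    using ne fin by (auto simp: card_gt_0_iff)
  have card: "5 * m = card A + card B"
    using card_Un_disjoint[OF fin disj] un by simp
  have w: "w p \<in> {0..1}" if "p \<in> {1..5}" for p
  proof -
    have "card {i\<in>A. block m i = p} \<le> card {i \<in> {1..5 * m}. block m i = p}"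
      using A by (intro card_mono) auto
    then have "card {i\<in>A. block m i = p} \<le> m"
      unfolding card_block[OF m that] .
    then show ?thesis using m by (simp add: w_def)
  qed
  have cardA: "m * (\<Sum>p\<in>{1..5}. w p) = card A"
    using sum_block[OF m A, of "\<lambda>_. 1 :: real"] m by (simp add: w_def sum_distrib_left)
  have "5 * real m = card A + card B"
    using card by (metis of_nat_add of_nat_mult of_nat_numeral)
  then have cardB: "m * (5 - (\<Sum>p\<in>{1..5}. w p)) = card B"
    using cardA by (simp add: algebra_simps)
  have "(\<Sum>i\<in>A. center (block m i)) = m *\<^sub>R (\<Sum>p\<in>{1..5}. w p *\<^sub>R center p)"
    using sum_block[OF m A, of center] m by (simp add: w_def scaleR_sum_right)
  then have "(norm (\<Sum>i\<in>A. center (block m i)))\<^sup>2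
      = (real m)\<^sup>2 * (norm (\<Sum>p\<in>{1..5}. w p *\<^sub>R center p))\<^sup>2"
    by (simp add: power_mult_distrib)
  also have "\<dots> \<le> (real m)\<^sup>2 * (7/72 * ((\<Sum>p\<in>{1..5}. w p) * (5 - (\<Sum>p\<in>{1..5}. w p))))"
    by (intro mult_left_mono norm_weighted_center_sum_le w) auto
  also have "\<dots> = 7/72 * (card A * card B)"
    unfolding of_nat_mult cardA[symmetric] cardB[symmetric] by (simp add: power2_eq_square)
  finally have "(norm (\<Sum>i\<in>A. center (block m i)))\<^sup>2 / (card A * card B) \<le> 7/72"
    using pos by (simp add: divide_le_eq)
  then have "10 * m * ((norm (\<Sum>i\<in>A. center (block m i)))\<^sup>2 / (card A * card B)) \<le> 10 * m * (7/72)"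
    by (intro mult_left_mono) auto
  moreover have "(\<Sum>i\<in>{1..5 * m}. center (block m i)) = 0"
    using sum_all_blocks[OF m, of center] sum_center by simp
  note objective_cluster_centered[OF part this]
  moreover have "(\<Sum>i\<in>{1..5 * m}. (norm (center (block m i)))\<^sup>2) = m * (3/2)"
    using sum_all_blocks[OF m, of "\<lambda>p. (norm (center p))\<^sup>2"] sum_norm_center_sq by simp
  ultimately show ?thesis
    by simp
qed

lemma kmeans2_value_lower:
  assumes m: "m \<ge> 1" and r: "r \<le> 3/1000"
    and ball: "\<And>i. i \<in> {1..5 * m} \<Longrightarrow> dist (center (block m i)) (y i) \<le> r"
  shows "m * 1.967 \<le> kmeans2_value (5 * m) (sqdist y)"
proof -
  let ?n = "5 * m"
  let ?V = "{objective ?n (sqdist y) X | X. \<exists>A B. partition2 ?n A B \<and> X = cluster_matrix A B}"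
  have "?V \<subseteq> (\<lambda>(A, B). objective ?n (sqdist y) (cluster_matrix A B)) `
      (Pow {1..?n} \<times> Pow {1..?n})"
    by (auto simp: partition2_def)
  then have fin: "finite ?V"
    by (rule finite_subset) auto
  have "partition2 ?n {1} {2..?n}"
    using m by (auto simp: partition2_def)
  then have ne: "?V \<noteq> {}"
    by blast
  from Min_in[OF fin ne] obtain A B where part: "partition2 ?n A B"
    and val: "kmeans2_value ?n (sqdist y) = objective ?n (sqdist y) (cluster_matrix A B)"
    unfolding kmeans2_value_def by auto
  have "A \<union> B = {1..?n}" and disj: "A \<inter> B = {}" and ne: "A \<noteq> {}" "B \<noteq> {}"
    using part by (auto simp: partition2_def)
  moreover from this have fin: "finite A" "finite B"
    by (metis finite_Un finite_atLeastAtMost)+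
  ultimately have card: "card A + card B = 5 * m"
    using card_Un_disjoint[OF fin disj] by simp
  let ?D = "\<lambda>i j. (norm (center (block m i) - center (block m j)))\<^sup>2"
  have d: "?D i j - 12/1000 \<le> sqdist y i j" if "i \<in> {1..?n}" "j \<in> {1..?n}" for i j
  proof -
    have "?D i j \<le> 1\<^sup>2"
      using norm_center_diff[OF block_range[OF m that(1)] block_range[OF m that(2)]]
      by (simp add: center_sqdist_def)
    then have "norm (center (block m i) - center (block m j)) \<le> 1"
      by (rule power2_le_imp_le) simp
    from sqdist_perturbed_lower[OF ball[OF that(1)] ball[OF that(2)] this] r
    show ?thesis by (simp add: sqdist_def)
  qed
  have "objective ?n (\<lambda>_ _. 1) (cluster_matrix A B) = card A + card B"
    using ne fin by (simp add: objective_cluster_matrix[OF part])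
  then have total: "objective ?n (\<lambda>_ _. 1) (cluster_matrix A B) = 5 * m"
    using card by (metis of_nat_add)
  have "m * 1.967 \<le> 73/36 * m - 12/1000 * (5 * m)"
    by simp
  also have "\<dots> \<le> objective ?n ?D (cluster_matrix A B)
      - 12/1000 * objective ?n (\<lambda>_ _. 1) (cluster_matrix A B)"
    unfolding total using objective_centers_lower[OF m part] by simp
  also have "\<dots> = objective ?n (\<lambda>i j. ?D i j - 12/1000) (cluster_matrix A B)"
    by (simp add: objective_def sum_distrib_left sum_subtractf left_diff_distrib)
  also have "\<dots> \<le> objective ?n (sqdist y) (cluster_matrix A B)"
    unfolding objective_def
    by (intro sum_mono mult_right_mono d) (auto simp: cluster_matrix_def)
  finally show ?thesis
    unfolding val .
qed

theorem proposition6: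
  fixes r :: real and n :: nat and y :: "nat \<Rightarrow> real ^ 3"
  assumes "0 \<le> r" and "r \<le> 3 * 10 powi (-3)"
    and "five_ball_instance r n y"
  shows "LP2_value n (sqdist y) < ereal (kmeans2_value n (sqdist y))"
proof -
  have r: "r \<le> 3/1000"
    using assms(2) by (simp add: power_int_minus field_simps)
  from assms(3) obtain m where m: "m \<ge> 1" and n: "n = 5 * m"
    and blocks: "\<forall>p\<in>{1..5}. {i \<in> {1..5 * m}. y i \<in> cball (center p) r} = {(p - 1) * m + 1..p * m}"
    unfolding five_ball_instance_def by auto
  note ball = instance_in_balls[OF blocks m]
  have "LP2_value n (sqdist y) \<le> ereal (m * 1.965)"
    unfolding n by (rule LP2_value_upper[OF m r ball])
  also have "\<dots> < ereal (m * 1.967)"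
    using m by simp
  also have "\<dots> \<le> ereal (kmeans2_value n (sqdist y))"
    unfolding n using kmeans2_value_lower[OF m r ball] by simp
  finally show ?thesis .
qed

end
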